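(* Let $\bar\mu>0$ and $\bar\sigma>0$ be constants. Then $\bar g'(0)=\bar\sigma^2$, so that $$\bar g(\theta)=1+\bar\sigma^2\theta+o(\theta)\qquad(\theta\to0+).$$
   Context: $\Phi$ is the standard normal cumulative distribution function. For $\mu,\sigma>0$ the normal censor $W=W(\mu,\sigma)$ is the unique real solution $W$ of $$e^{-\mu}=\Phi(W-\sigma)+e^{\sigma W-\frac12\sigma^2}\Phi(-W).$$ The profit function (for the Cobb-Douglas revenue $f(x)=2\sqrt x$) is $$g(\mu,\sigma)=e^{\sigma^2-\mu}\Phi(W+\sigma)+e^{-\mu-\sigma W+\frac12\sigma^2}\Phi(-W),\qquad W=W(\mu,\sigma).$$ For $0<\theta<\infty$ put $\bar g(\theta)=g(\bar\mu\theta,\bar\sigma\sqrt\theta)$, and $\bar g(0)=1$; the derivative at $0$ is the right-hand derivative. *)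

theory Defs
  imports "HOL-Probability.Probability"
begin

definition std_normal_cdf :: "real \<Rightarrow> real" where
  "std_normal_cdf = cdf std_normal_distribution"

(* For \<mu>, \<sigma> > 0 the solution exists and is unique; the value is unspecified otherwise. *)
definition normal_censor :: "real \<Rightarrow> real \<Rightarrow> real" where
  "normal_censor \<mu> \<sigma> =
     (THE W. exp (- \<mu>) =
        std_normal_cdf (W - \<sigma>) + exp (\<sigma> * W - \<sigma>\<^sup>2 / 2) * std_normal_cdf (- W))"

(* Profit function for the Cobb-Douglas revenue f(x) = 2 sqrt x. *)
definition profit :: "real \<Rightarrow> real \<Rightarrow> real" where
  "profit \<mu> \<sigma> =
     (let W = normal_censor \<mu> \<sigma> in
        exp (\<sigma>\<^sup>2 - \<mu>) * std_normal_cdf (W + \<sigma>)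
        + exp (- \<mu> - \<sigma> * W + \<sigma>\<^sup>2 / 2) * std_normal_cdf (- W))"

(* Meaningful for \<theta> \<ge> 0 only. The value at 0 is set by convention, not by the formula for profit. *)
definition profit_bar :: "real \<Rightarrow> real \<Rightarrow> real \<Rightarrow> real" where
  "profit_bar \<mu> \<sigma> \<theta> = (if \<theta> = 0 then 1 else profit (\<mu> * \<theta>) (\<sigma> * sqrt \<theta>))"

end

theory Submission
  imports Defs "HOL-Real_Asymp.Real_Asymp"
begin

text \<open>
  Let \<open>\<Phi>\<close> and \<open>\<phi>\<close> be the standard normal distribution function and density, and put
  \<open>h(W, s) = \<Phi>(s - W) - exp (s W - s\<^sup>2 / 2) \<Phi>(- W)\<close> (\<open>tail_excess\<close>). The reflection
  \<open>\<Phi>(- x) = 1 - \<Phi>(x)\<close> turns the equation for the censor \<open>W\<close> into \<open>h(W, \<sigma>) = 1 - exp (- \<mu>)\<close>.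
  It also factorises the profit
  (\<open>profit_eq_tail_excess_product\<close>):
  \<open>g(\<mu>, \<sigma>) = exp (\<sigma>\<^sup>2) (1 - h(W, \<sigma>)) (1 - h(W, - \<sigma>))\<close>.
  The factor \<open>exp (\<sigma>\<^sup>2)\<close> alone has the desired first-order behaviour, so the product of the other
  two factors has to be \<open>1 + o(\<sigma>\<^sup>2)\<close>. Along the path \<open>(\<mu> \<theta>, \<sigma> sqrt \<theta>)\<close> the first of these is
  \<open>exp (- \<mu> \<theta>)\<close>, which does differ from 1 to first order; the second one cancels this difference
  because \<open>h\<close> is almost odd in its second argument.

  Indeed \<open>h(W, 0) = 0\<close>, so \<open>h(W, s) + h(W, - s)\<close> is at most \<open>s\<^sup>2\<close> times a bound on the second
  derivative of \<open>h\<close> in \<open>s\<close>. For \<open>\<bar>s\<bar> \<le> 1 \<le> W\<close> that derivative is dominated by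
  \<open>exp W (W + 2)\<^sup>2 \<phi>(W)\<close>, which vanishes as \<open>W \<rightarrow> \<infinity>\<close> (\<open>tail_excess_almost_odd\<close>).
  It remains to see that the censor tends to infinity (\<open>normal_censor_at_top\<close>).
  At a fixed threshold \<open>K > 0\<close>, the excess \<open>h(K, s)\<close> is of exact order \<open>s\<close>, with slope
  \<open>\<phi>(K) - K \<Phi>(- K) > 0\<close> at the origin, hence of order \<open>sqrt \<theta>\<close>, whereas the value required of
  the censor is \<open>1 - exp (- \<mu> \<theta>)\<close>, of order \<open>\<theta>\<close>. As \<open>h\<close> decreases in \<open>W\<close>, the censor ends up
  above \<open>K\<close>.
\<close>

section \<open>The normal distribution function and its tail\<close>

lemma std_normal_density_continuous: "continuous_on A std_normal_density"
  unfolding std_normal_density_def by (intro continuous_intros) auto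

lemma std_normal_cdf_diff:
  assumes "a \<le> b"
  shows "std_normal_cdf b - std_normal_cdf a = integral {a..b} std_normal_density"
proof (cases "a = b")
  case False
  with assms have ab: "a < b" by simp
  interpret real_distribution std_normal_distribution by (rule real_dist_normal_dist)
  define G where "G x = integral {a - 1..x} std_normal_density" for x
  have G: "(G has_real_derivative std_normal_density x) (at x)" if "x \<in> {a..b}" for x
  proof -
    have "(G has_real_derivative std_normal_density x) (at x within {a - 1..b + 1})"
      unfolding G_def
      by (rule integral_has_real_derivative[OF std_normal_density_continuous]) (use that in auto)
    moreover have "at x within {a - 1..b + 1} = at x"
      by (rule at_within_interior) (use that in \<open>simp add: interior_atLeastAtMost_real\<close>)
    ultimately show ?thesis by simp
  qed
  have Gba: "G b - G a = integral {a..b} std_normal_density"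
    unfolding G_def using ab
      Henstock_Kurzweil_Integration.integral_combine[of "a - 1" a b std_normal_density]
    by (simp add: integrable_continuous_interval std_normal_density_continuous)
  have Gba_nonneg: "G b - G a \<ge> 0"
    unfolding Gba
    by (intro integral_nonneg integrable_continuous_interval std_normal_density_continuous) simp
  have "emeasure std_normal_distribution {a<..b} =
      (\<integral>\<^sup>+ x. ennreal (std_normal_density x) * indicator {a<..b} x \<partial>lborel)"
    by (simp add: emeasure_density)
  also have "\<dots> = (\<integral>\<^sup>+ x. ennreal (std_normal_density x) * indicator {a..b} x \<partial>lborel)"
    by (intro nn_integral_cong_AE eventually_mono[OF AE_lborel_singleton[of a]])
       (auto simp: indicator_def)
  also have "\<dots> = ennreal (G b - G a)"
    by (rule nn_integral_FTC_Icc) (use G ab in auto)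
  finally have "measure std_normal_distribution {a<..b} = G b - G a"
    using Gba_nonneg by (simp add: measure_def)
  then show ?thesis
    using cdf_diff_eq[OF ab] by (simp add: std_normal_cdf_def Gba)
qed simp

lemma std_normal_cdf_has_derivative:
  "(std_normal_cdf has_real_derivative std_normal_density x) (at x)"
proof -
  let ?G = "\<lambda>y. std_normal_cdf (x - 1) + integral {x - 1..y} std_normal_density"
  have "((\<lambda>y. integral {x - 1..y} std_normal_density) has_real_derivative std_normal_density x)
      (at x within {x - 1..x + 1})"
    by (rule integral_has_real_derivative[OF std_normal_density_continuous]) simp
  moreover have "at x within {x - 1..x + 1} = at x"
    by (rule at_within_interior) (simp add: interior_atLeastAtMost_real)
  ultimately have "((\<lambda>y. integral {x - 1..y} std_normal_density) has_real_derivative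
      std_normal_density x) (at x)" by simp
  then have "(?G has_real_derivative 0 + std_normal_density x) (at x)"
    by (intro DERIV_add) auto
  moreover have "?G y = std_normal_cdf y" if "y \<in> {x - 1<..}" for y
    using std_normal_cdf_diff[of "x - 1" y] that by auto
  ultimately show ?thesis
    using has_field_derivative_transform_within_open[of ?G "std_normal_density x" x "{x - 1<..}"]
    by simp
qed

lemmas std_normal_cdf_has_derivative_chain [derivative_intros] =
  DERIV_chain2[OF std_normal_cdf_has_derivative]

lemma std_normal_cdf_at_bot: "(std_normal_cdf \<longlongrightarrow> 0) at_bot"
  and std_normal_cdf_at_top: "(std_normal_cdf \<longlongrightarrow> 1) at_top"
  and std_normal_cdf_nonneg: "std_normal_cdf x \<ge> 0"
proof -
  interpret real_distribution std_normal_distribution by (rule real_dist_normal_dist)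
  show "(std_normal_cdf \<longlongrightarrow> 0) at_bot" "(std_normal_cdf \<longlongrightarrow> 1) at_top" "std_normal_cdf x \<ge> 0"
    unfolding std_normal_cdf_def
    by (rule cdf_lim_at_bot cdf_lim_at_top_prob cdf_nonneg)+
qed

lemma std_normal_cdf_pos: "std_normal_cdf x > 0"
  by (rule DERIV_pos_imp_increasing_at_bot[OF _ std_normal_cdf_at_bot])
     (blast intro: std_normal_cdf_has_derivative normal_density_pos[OF zero_less_one])

lemma std_normal_tail_at_top: "((\<lambda>x. std_normal_cdf (c - x)) \<longlongrightarrow> 0) at_top"
  by (rule filterlim_compose[OF std_normal_cdf_at_bot]) real_asymp

lemma std_normal_density_has_derivative:
  "(std_normal_density has_real_derivative - x * std_normal_density x) (at x)"
  unfolding std_normal_density_def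
  by (auto intro!: derivative_eq_intros simp: field_simps power2_eq_square)

lemma std_normal_density_minus: "std_normal_density (- x) = std_normal_density x"
  by (simp add: std_normal_density_def)

lemma std_normal_cdf_minus: "std_normal_cdf (- x) = 1 - std_normal_cdf x"
proof -
  let ?S = "\<lambda>y. std_normal_cdf y + std_normal_cdf (- y)"
  have "(?S has_real_derivative 0) (at y)" for y
    by (auto intro!: derivative_eq_intros simp: std_normal_density_minus)
  then have const: "?S y = ?S x" for y
    by (rule DERIV_isconst_all[of ?S y x, rule_format])
  have lim: "(?S \<longlongrightarrow> 1 + 0) at_top"
    using std_normal_tail_at_top[of 0] by (intro tendsto_add std_normal_cdf_at_top) simp
  have "?S = (\<lambda>_. ?S x)"
    by (rule ext) (rule const)
  with lim have "((\<lambda>_. ?S x) \<longlongrightarrow> 1) (at_top :: real filter)"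
    by (metis add.right_neutral)
  then have "?S x = 1"
    by (simp add: tendsto_const_iff)
  then show ?thesis by simp
qed

text \<open>The function \<open>\<phi>(x) / x - \<Phi>(- x)\<close> has derivative \<open>- \<phi>(x) / x\<^sup>2 < 0\<close> and tends to 0 at infinity,
  so it is positive.\<close>

lemma mills_upper_bound:
  assumes "x > 0"
  shows "x * std_normal_cdf (- x) < std_normal_density x"
proof -
  let ?q = "\<lambda>x. std_normal_density x / x - std_normal_cdf (- x)"
  have "0 < ?q x"
  proof (rule DERIV_neg_imp_decreasing_at_top[where f = ?q and b = x])
    fix y assume "x \<le> y"
    then have y: "y > 0" using assms by simp
    have "(?q has_real_derivative - std_normal_density y / y\<^sup>2) (at y)"
      using y by (auto intro!: derivative_eq_intros std_normal_density_has_derivative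
          simp: std_normal_density_minus power2_eq_square field_simps)
    moreover have "- std_normal_density y / y\<^sup>2 < 0"
      using y normal_density_pos[of 1 0 y] by simp
    ultimately show "\<exists>d. (?q has_real_derivative d) (at y) \<and> d < 0" by blast
  next
    have "((\<lambda>x. std_normal_density x / x) \<longlongrightarrow> 0) at_top"
      unfolding std_normal_density_def by real_asymp
    from tendsto_diff[OF this std_normal_tail_at_top[of 0]]
    show "(?q \<longlongrightarrow> 0) at_top" by simp
  qed
  then show ?thesis using assms by (simp add: field_simps)
qed

lemma mills_upper_bound_weak:
  assumes "x \<ge> 1"
  shows "std_normal_cdf (- x) \<le> std_normal_density x"
proof -
  have "std_normal_cdf (- x) \<le> x * std_normal_cdf (- x)"
    using mult_right_mono[OF assms std_normal_cdf_nonneg[of "- x"]] by simp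
  with mills_upper_bound[of x] assms show ?thesis by simp
qed

section \<open>The normalised excess over a threshold\<close>

text \<open>For a standard normal variable \<open>Z\<close> this is the expectation of
  \<open>exp (s Z) - exp (s W)\<close> on the event \<open>Z > W\<close>, divided by the expectation of \<open>exp (s Z)\<close>. When
  \<open>s > 0\<close> it is the value of a call option in the Black-Scholes model, relative to the stock price.
  Negative \<open>s\<close> occurs in the profit.\<close>

definition tail_excess :: "real \<Rightarrow> real \<Rightarrow> real" where
  "tail_excess W s = std_normal_cdf (s - W) - exp (s * W - s\<^sup>2 / 2) * std_normal_cdf (- W)"

lemma censor_equation_iff_tail_excess:
  "exp (- \<mu>) = std_normal_cdf (W - \<sigma>) + exp (\<sigma> * W - \<sigma>\<^sup>2 / 2) * std_normal_cdf (- W)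
    \<longleftrightarrow> tail_excess W \<sigma> = 1 - exp (- \<mu>)"
  using std_normal_cdf_minus[of "\<sigma> - W"] by (auto simp: tail_excess_def)

text \<open>This exponential tilting identity is what makes the boundary terms cancel or combine whenever
  \<open>tail_excess\<close> is differentiated.\<close>

lemma std_normal_density_shift:
  "std_normal_density (s - W) = exp (s * W - s\<^sup>2 / 2) * std_normal_density W"
proof -
  \<comment> \<open>completing the square\<close>
  have "- (s - W)\<^sup>2 / 2 = (s * W - s\<^sup>2 / 2) + - W\<^sup>2 / 2"
    by (simp add: power2_eq_square field_simps)
  then show ?thesis by (simp add: std_normal_density_def exp_add[symmetric])
qed

lemma tail_excess_deriv_threshold:
  "((\<lambda>W. tail_excess W s) has_real_derivative
      - s * exp (s * W - s\<^sup>2 / 2) * std_normal_cdf (- W)) (at W)"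
  unfolding tail_excess_def
  by (auto intro!: derivative_eq_intros
      simp: std_normal_density_minus std_normal_density_shift algebra_simps)

lemma tail_excess_strict_antimono:
  assumes "s > 0" "V < W"
  shows "tail_excess W s < tail_excess V s"
proof (rule DERIV_neg_imp_decreasing[OF assms(2)])
  fix x
  show "\<exists>d. ((\<lambda>W. tail_excess W s) has_real_derivative d) (at x) \<and> d < 0"
    using tail_excess_deriv_threshold[of s x] assms(1) std_normal_cdf_pos[of "- x"]
    by (intro exI[of _ "- s * exp (s * x - s\<^sup>2 / 2) * std_normal_cdf (- x)"]) simp
qed

lemma tail_excess_at_bot:
  assumes "s > 0"
  shows "((\<lambda>W. tail_excess W s) \<longlongrightarrow> 1) at_bot"
proof -
  have "((\<lambda>W. std_normal_cdf (s - W)) \<longlongrightarrow> 1) at_bot" "((\<lambda>W. std_normal_cdf (- W)) \<longlongrightarrow> 1) at_bot"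
    by (rule filterlim_compose[OF std_normal_cdf_at_top], real_asymp)+
  moreover have "((\<lambda>W. exp (s * W - s\<^sup>2 / 2)) \<longlongrightarrow> 0) at_bot"
    using assms by real_asymp
  ultimately have "((\<lambda>W. tail_excess W s) \<longlongrightarrow> 1 - 0 * 1) at_bot"
    unfolding tail_excess_def by (intro tendsto_intros)
  then show ?thesis by simp
qed

lemma tail_excess_at_top: "((\<lambda>W. tail_excess W s) \<longlongrightarrow> 0) at_top"
proof -
  \<comment> \<open>By the Mills bound, the second term is dominated by a shifted normal density.\<close>
  let ?B = "\<lambda>W. exp (s * W - s\<^sup>2 / 2) * std_normal_density W"
  have "(?B \<longlongrightarrow> 0) at_top"
    unfolding std_normal_density_shift[symmetric] unfolding std_normal_density_def by real_asymp
  then have "((\<lambda>W. exp (s * W - s\<^sup>2 / 2) * std_normal_cdf (- W)) \<longlongrightarrow> 0) at_top"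
    by (rule Lim_null_comparison[rotated])
       (auto intro!: eventually_mono[OF eventually_ge_at_top[of 1]] mills_upper_bound_weak
         simp: std_normal_cdf_nonneg abs_mult)
  from tendsto_diff[OF std_normal_tail_at_top this] show ?thesis
    unfolding tail_excess_def by simp
qed

text \<open>For \<open>s > 0\<close> the excess decreases continuously and strictly from 1 to 0 as the threshold runs
  through the real line. This is why the definite description defining the censor is meaningful.\<close>

lemma ex1_tail_excess_eq:
  assumes "s > 0" "0 < u" "u < 1"
  shows "\<exists>!W. tail_excess W s = u"
proof -
  obtain A where A: "\<And>W. W \<le> A \<Longrightarrow> u < tail_excess W s"
    using order_tendstoD(1)[OF tail_excess_at_bot[OF assms(1)] assms(3)]
    by (auto simp: eventually_at_bot_linorder)
  obtain B where B: "\<And>W. W \<ge> B \<Longrightarrow> tail_excess W s < u"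
    using order_tendstoD(2)[OF tail_excess_at_top assms(2)]
    by (auto simp: eventually_at_top_linorder)
  have "\<exists>W\<ge>min A B. W \<le> max A B \<and> tail_excess W s = u"
  proof (rule IVT2)
    show "tail_excess (max A B) s \<le> u" "u \<le> tail_excess (min A B) s"
      using A[of "min A B"] B[of "max A B"] by simp_all
    show "\<forall>W. min A B \<le> W \<and> W \<le> max A B \<longrightarrow> isCont (\<lambda>W. tail_excess W s) W"
      using tail_excess_deriv_threshold DERIV_isCont by blast
  qed simp
  moreover have "V = W" if "tail_excess V s = u" "tail_excess W s = u" for V W
    using tail_excess_strict_antimono[OF assms(1)] that by (metis less_irrefl linorder_neqE)
  ultimately show ?thesis by blast
qed

lemma tail_excess_normal_censor:
  assumes "\<mu> > 0" "\<sigma> > 0"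
  shows "tail_excess (normal_censor \<mu> \<sigma>) \<sigma> = 1 - exp (- \<mu>)"
  unfolding normal_censor_def censor_equation_iff_tail_excess
  by (rule theI'[OF ex1_tail_excess_eq]) (use assms in auto)

text \<open>The censor equation replaces \<open>exp (- \<mu>)\<close> by \<open>1 - tail_excess W \<sigma>\<close>. The profit is
  \<open>exp (\<sigma>\<^sup>2 - \<mu>)\<close> times the right-hand side of that equation with \<open>\<sigma>\<close> negated, which reflection
  turns into \<open>1 - tail_excess W (- \<sigma>)\<close>.\<close>

lemma profit_eq_tail_excess_product:
  assumes "\<mu> > 0" "\<sigma> > 0"
  defines "W \<equiv> normal_censor \<mu> \<sigma>"
  shows "profit \<mu> \<sigma> = exp (\<sigma>\<^sup>2) * (1 - tail_excess W \<sigma>) * (1 - tail_excess W (- \<sigma>))"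
proof -
  have e: "exp (- \<mu>) = 1 - tail_excess W \<sigma>"
    unfolding W_def using tail_excess_normal_censor[OF assms(1,2)] by simp
  have c: "std_normal_cdf (- \<sigma> - W) = 1 - std_normal_cdf (W + \<sigma>)"
    unfolding std_normal_cdf_minus[symmetric] by (rule arg_cong[of _ _ std_normal_cdf]) simp
  have "exp (\<sigma>\<^sup>2) * (1 - tail_excess W (- \<sigma>)) =
      exp (\<sigma>\<^sup>2) * std_normal_cdf (W + \<sigma>) + exp (\<sigma>\<^sup>2 + (- \<sigma> * W - \<sigma>\<^sup>2 / 2)) * std_normal_cdf (- W)"
    by (simp only: exp_add) (simp add: tail_excess_def c algebra_simps)
  also have "\<sigma>\<^sup>2 + (- \<sigma> * W - \<sigma>\<^sup>2 / 2) = - \<sigma> * W + \<sigma>\<^sup>2 / 2" by simp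
  finally have "exp (- \<mu>) * (exp (\<sigma>\<^sup>2) * (1 - tail_excess W (- \<sigma>))) =
      exp (\<sigma>\<^sup>2 + - \<mu>) * std_normal_cdf (W + \<sigma>)
      + exp (- \<mu> + (- \<sigma> * W + \<sigma>\<^sup>2 / 2)) * std_normal_cdf (- W)"
    by (simp only: exp_add) (simp add: algebra_simps)
  also have "\<dots> = profit \<mu> \<sigma>"
    unfolding profit_def Let_def W_def[symmetric] by (simp add: algebra_simps)
  finally show ?thesis unfolding e by (simp add: mult_ac)
qed

section \<open>Expansion for small volatility\<close>

text \<open>The first and second derivatives of \<open>tail_excess\<close> in its second argument. At 0 the slope is
  \<open>\<phi>(W) - W \<Phi>(- W)\<close>, the expectation of the positive part of \<open>Z - W\<close> for a standard normal \<open>Z\<close>.\<close>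

definition tail_excess_slope :: "real \<Rightarrow> real \<Rightarrow> real" where
  "tail_excess_slope W s =
     exp (s * W - s\<^sup>2 / 2) * (std_normal_density W - (W - s) * std_normal_cdf (- W))"

definition tail_excess_curvature :: "real \<Rightarrow> real \<Rightarrow> real" where
  "tail_excess_curvature W s =
     exp (s * W - s\<^sup>2 / 2) *
       ((W - s) * (std_normal_density W - (W - s) * std_normal_cdf (- W)) + std_normal_cdf (- W))"

lemma tail_excess_deriv_slope:
  "(tail_excess W has_real_derivative tail_excess_slope W s) (at s)"
  unfolding tail_excess_def[abs_def] tail_excess_slope_def
  by (auto intro!: derivative_eq_intros simp: std_normal_density_shift algebra_simps)

lemma tail_excess_slope_deriv_curvature:
  "(tail_excess_slope W has_real_derivative tail_excess_curvature W s) (at s)"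
  unfolding tail_excess_slope_def[abs_def] tail_excess_curvature_def
  by (auto intro!: derivative_eq_intros simp: algebra_simps)

lemma tail_excess_0: "tail_excess W 0 = 0"
  by (simp add: tail_excess_def)

text \<open>A crude bound on the curvature is enough: the Gaussian factor beats the exponential and the
  polynomial, so that the bound vanishes at infinity however slowly the threshold grows.\<close>

definition curvature_bound :: "real \<Rightarrow> real" where
  "curvature_bound W = exp W * ((W + 2)\<^sup>2 * std_normal_density W)"

lemma curvature_bound_at_top: "(curvature_bound \<longlongrightarrow> 0) at_top"
  unfolding curvature_bound_def[abs_def] std_normal_density_def by real_asymp

lemma tail_excess_curvature_bound:
  assumes "W \<ge> 1" "\<bar>s\<bar> \<le> 1"
  shows "\<bar>tail_excess_curvature W s\<bar> \<le> curvature_bound W"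
proof -
  let ?f = "std_normal_density W" and ?t = "std_normal_cdf (- W)"
  have f: "0 \<le> ?f" and t: "0 \<le> ?t" "?t \<le> ?f"
    using mills_upper_bound_weak[OF assms(1)] std_normal_cdf_nonneg by simp_all
  have d: "0 \<le> W - s" "W - s \<le> W + 1" using assms by auto
  have "0 \<le> (W - s) * ?t" "(W - s) * ?t \<le> (W + 1) * ?f"
    using d f t assms by (auto intro!: mult_mono)
  then have "\<bar>?f - (W - s) * ?t\<bar> \<le> ?f + (W + 1) * ?f" using f by linarith
  then have "(W - s) * \<bar>?f - (W - s) * ?t\<bar> \<le> (W + 1) * (?f + (W + 1) * ?f)"
    using d assms by (intro mult_mono) auto
  then have "\<bar>(W - s) * (?f - (W - s) * ?t) + ?t\<bar> \<le> (W + 1) * (?f + (W + 1) * ?f) + ?f"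
    using abs_triangle_ineq[of "(W - s) * (?f - (W - s) * ?t)" ?t] d t by (simp add: abs_mult)
  also have "\<dots> \<le> (W + 2)\<^sup>2 * ?f"
    using mult_nonneg_nonneg[OF _ f, of "W + 1"] assms
    by (simp add: power2_eq_square algebra_simps)
  finally have "\<bar>(W - s) * (?f - (W - s) * ?t) + ?t\<bar> \<le> (W + 2)\<^sup>2 * ?f" .
  moreover have "exp (s * W - s\<^sup>2 / 2) \<le> exp W"
    using mult_right_mono[of s 1 W] assms by (auto intro: add_increasing2 order_trans[of _ "s * W"])
  ultimately show ?thesis
    unfolding tail_excess_curvature_def curvature_bound_def abs_mult
    by (intro mult_mono) auto
qed

lemma tail_excess_linear_error:
  assumes "W \<ge> 1" "\<bar>s\<bar> \<le> 1"
  shows "\<bar>tail_excess W s - tail_excess_slope W 0 * s\<bar> \<le> curvature_bound W * s\<^sup>2 / 2"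
proof -
  define D where "D m = (if m = 0 then tail_excess W else if m = 1 then tail_excess_slope W
    else tail_excess_curvature W)" for m :: nat
  have "D 0 = tail_excess W" by (simp add: D_def)
  moreover have "(D m has_real_derivative D (Suc m) x) (at x)" if "m < 2" for m x
    using that less_2_cases[OF that] tail_excess_deriv_slope tail_excess_slope_deriv_curvature
    by (auto simp: D_def)
  ultimately obtain t where t: "\<bar>t\<bar> \<le> \<bar>s\<bar>"
    and "tail_excess W s = (\<Sum>m<2. D m 0 / fact m * s ^ m) + D 2 t / fact 2 * s\<^sup>2"
    using Maclaurin_bi_le[of D "tail_excess W" 2 s] by blast
  then have "tail_excess W s - tail_excess_slope W 0 * s = tail_excess_curvature W t * s\<^sup>2 / 2"
    by (simp add: D_def numeral_2_eq_2 tail_excess_0)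
  moreover have "\<bar>tail_excess_curvature W t\<bar> * s\<^sup>2 \<le> curvature_bound W * s\<^sup>2"
    using t assms by (intro mult_right_mono tail_excess_curvature_bound) auto
  ultimately show ?thesis by (simp only: abs_mult abs_divide) simp
qed

text \<open>The linear Taylor terms at \<open>s\<close> and \<open>- s\<close> cancel, and only the two quadratic errors remain.\<close>

lemma tail_excess_almost_odd:
  assumes "W \<ge> 1" "\<bar>s\<bar> \<le> 1"
  shows "\<bar>tail_excess W s + tail_excess W (- s)\<bar> \<le> curvature_bound W * s\<^sup>2"
proof -
  have "\<bar>tail_excess W (- s) - tail_excess_slope W 0 * (- s)\<bar> \<le> curvature_bound W * (- s)\<^sup>2 / 2"
    using assms by (intro tail_excess_linear_error) auto
  with tail_excess_linear_error[OF assms] show ?thesis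
    unfolding mult_minus_right power2_minus by linarith
qed

section \<open>The censor at short horizons\<close>

lemma sqrt_at_right_0: "filterlim (\<lambda>\<theta>. c * sqrt \<theta>) (at_right 0) (at_right 0)" if "c > 0" for c :: real
  using that by real_asymp

text \<open>At any fixed threshold \<open>K > 0\<close> the excess is of order \<open>sqrt \<theta>\<close> and thus eventually exceeds the
  value \<open>1 - exp (- \<mu> \<theta>)\<close> that it takes at the censor; by monotonicity the censor is above \<open>K\<close>.\<close>

lemma normal_censor_at_top:
  assumes "\<mu> > 0" "\<sigma> > 0"
  shows "filterlim (\<lambda>\<theta>. normal_censor (\<mu> * \<theta>) (\<sigma> * sqrt \<theta>)) at_top (at_right 0)"
  unfolding filterlim_at_top_gt[where c = 0]
proof (intro allI impI)
  fix K :: real assume K: "K > 0"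
  let ?m = "tail_excess_slope K 0"
  have m: "?m > 0"
    using mills_upper_bound[OF K] by (simp add: tail_excess_slope_def)
  have "((\<lambda>s. tail_excess K s / s) \<longlongrightarrow> ?m) (at_right 0)"
    using tail_excess_deriv_slope[of K 0] unfolding has_field_derivative_iff
    by (auto simp: tail_excess_0 intro: filterlim_mono at_le)
  from filterlim_compose[OF this sqrt_at_right_0[OF assms(2)]]
  have "((\<lambda>\<theta>. tail_excess K (\<sigma> * sqrt \<theta>) / (\<sigma> * sqrt \<theta>)) \<longlongrightarrow> ?m) (at_right 0)" .
  moreover have "((\<lambda>\<theta>. (1 - exp (- (\<mu> * \<theta>))) / (\<sigma> * sqrt \<theta>)) \<longlongrightarrow> 0) (at_right 0)"
    using assms by real_asymp
  ultimately have "\<forall>\<^sub>F \<theta> in at_right 0. (1 - exp (- (\<mu> * \<theta>))) / (\<sigma> * sqrt \<theta>) < ?m / 2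
      \<and> ?m / 2 < tail_excess K (\<sigma> * sqrt \<theta>) / (\<sigma> * sqrt \<theta>)"
    using m by (intro eventually_conj order_tendstoD[where y = 0] order_tendstoD[where y = ?m]) auto
  with eventually_at_right_less[of 0]
  show "\<forall>\<^sub>F \<theta> in at_right 0. K \<le> normal_censor (\<mu> * \<theta>) (\<sigma> * sqrt \<theta>)"
  proof eventually_elim
    case (elim \<theta>)
    let ?s = "\<sigma> * sqrt \<theta>" and ?W = "normal_censor (\<mu> * \<theta>) (\<sigma> * sqrt \<theta>)"
    have s: "?s > 0" using assms elim by simp
    have "(1 - exp (- (\<mu> * \<theta>))) / ?s < tail_excess K ?s / ?s" using elim by linarith
    then have "1 - exp (- (\<mu> * \<theta>)) < tail_excess K ?s"
      using s by (simp add: divide_less_cancel)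
    then have "tail_excess ?W ?s < tail_excess K ?s"
      using tail_excess_normal_censor[of "\<mu> * \<theta>" ?s] assms elim by simp
    then show ?case
      using tail_excess_strict_antimono[OF s, of ?W K] by (meson less_asym not_le)
  qed
qed

section \<open>The derivative of the profit at horizon zero\<close>

text \<open>With \<open>u = 1 - exp (- \<mu> \<theta>)\<close> for the excess at the censor and \<open>S\<close> for the sum of the excesses at
  plus and minus the volatility, the profit is
  \<open>exp (\<sigma>\<^sup>2 \<theta>) (1 - u) (1 + u - S) = exp (\<sigma>\<^sup>2 \<theta>) (1 + u (S - u) - S)\<close>.
  Here \<open>u = O(\<theta>)\<close> and \<open>S = o(\<theta>)\<close>, so only the exponential contributes to the derivative.\<close>

lemma profit_bar_difference_quotient:
  assumes "\<mu> > 0" "\<sigma> > 0"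
  shows "((\<lambda>\<theta>. (profit_bar \<mu> \<sigma> \<theta> - 1) / \<theta>) \<longlongrightarrow> \<sigma>\<^sup>2) (at_right 0)"
proof -
  define W where "W \<theta> = normal_censor (\<mu> * \<theta>) (\<sigma> * sqrt \<theta>)" for \<theta>
  define u where "u \<theta> = 1 - exp (- (\<mu> * \<theta>))" for \<theta>
  define S where "S \<theta> = tail_excess (W \<theta>) (\<sigma> * sqrt \<theta>) + tail_excess (W \<theta>) (- (\<sigma> * sqrt \<theta>))" for \<theta>
  \<comment> \<open>The difference quotient, arranged so that each part has a limit; \<open>S \<theta>\<close> appears as
    \<open>S \<theta> / \<theta> * \<theta>\<close> so that its limit follows from that of \<open>S \<theta> / \<theta>\<close>.\<close>
  define Q where "Q \<theta> = (exp (\<sigma>\<^sup>2 * \<theta>) - 1) / \<theta> +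
    exp (\<sigma>\<^sup>2 * \<theta>) * (u \<theta> / \<theta> * (S \<theta> / \<theta> * \<theta> - u \<theta>) - S \<theta> / \<theta>)" for \<theta>
  have W: "filterlim W at_top (at_right 0)"
    unfolding W_def by (rule normal_censor_at_top[OF assms])
  have small: "\<forall>\<^sub>F \<theta> in at_right 0. \<sigma> * sqrt \<theta> < 1"
    using assms by real_asymp
  have S: "((\<lambda>\<theta>. S \<theta> / \<theta>) \<longlongrightarrow> 0) (at_right 0)"
  proof (rule Lim_null_comparison)
    have "((\<lambda>\<theta>. curvature_bound (W \<theta>)) \<longlongrightarrow> 0) (at_right 0)"
      by (rule filterlim_compose[OF curvature_bound_at_top W])
    from tendsto_mult_right[OF this, of "\<sigma>\<^sup>2"]
    show "((\<lambda>\<theta>. curvature_bound (W \<theta>) * \<sigma>\<^sup>2) \<longlongrightarrow> 0) (at_right 0)" by simp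
    have "\<forall>\<^sub>F \<theta> in at_right 0. 1 \<le> W \<theta>"
      using W by (simp add: filterlim_at_top)
    with small eventually_at_right_less[of 0]
    show "\<forall>\<^sub>F \<theta> in at_right 0. norm (S \<theta> / \<theta>) \<le> curvature_bound (W \<theta>) * \<sigma>\<^sup>2"
    proof eventually_elim
      case (elim \<theta>)
      then have "\<bar>S \<theta>\<bar> \<le> curvature_bound (W \<theta>) * (\<sigma> * sqrt \<theta>)\<^sup>2"
        unfolding S_def using assms by (intro tail_excess_almost_odd) auto
      then show ?case
        using elim by (simp add: power_mult_distrib field_simps)
    qed
  qed
  have "(Q \<longlongrightarrow> \<sigma>\<^sup>2 + 1 * (\<mu> * (0 * 0 - 0) - 0)) (at_right 0)"
    unfolding Q_def u_def
  proof (intro tendsto_intros S)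
    show "((\<lambda>\<theta>. (exp (\<sigma>\<^sup>2 * \<theta>) - 1) / \<theta>) \<longlongrightarrow> \<sigma>\<^sup>2) (at_right 0)" by real_asymp
    show "((\<lambda>\<theta>. exp (\<sigma>\<^sup>2 * \<theta>)) \<longlongrightarrow> 1) (at_right 0)" by real_asymp
    show "((\<lambda>\<theta>. (1 - exp (- (\<mu> * \<theta>))) / \<theta>) \<longlongrightarrow> \<mu>) (at_right 0)" by real_asymp
    show "((\<lambda>\<theta>. 1 - exp (- (\<mu> * \<theta>))) \<longlongrightarrow> 0) (at_right 0)" by real_asymp
  qed
  then have "(Q \<longlongrightarrow> \<sigma>\<^sup>2) (at_right 0)" by simp
  moreover have "\<forall>\<^sub>F \<theta> in at_right 0. Q \<theta> = (profit_bar \<mu> \<sigma> \<theta> - 1) / \<theta>"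
    using eventually_at_right_less[of 0]
  proof eventually_elim
    case (elim \<theta>)
    let ?s = "\<sigma> * sqrt \<theta>"
    have u: "tail_excess (W \<theta>) ?s = u \<theta>"
      unfolding W_def u_def using tail_excess_normal_censor[of "\<mu> * \<theta>" ?s] assms elim by simp
    have "profit_bar \<mu> \<sigma> \<theta> = exp (\<sigma>\<^sup>2 * \<theta>) * (1 - u \<theta>) * (1 - (S \<theta> - u \<theta>))"
      using profit_eq_tail_excess_product[of "\<mu> * \<theta>" ?s] assms elim u
      by (simp add: profit_bar_def W_def[symmetric] S_def power_mult_distrib)
    then have "exp (\<sigma>\<^sup>2 * \<theta>) - 1 + exp (\<sigma>\<^sup>2 * \<theta>) * (u \<theta> * (S \<theta> - u \<theta>) - S \<theta>)
        = profit_bar \<mu> \<sigma> \<theta> - 1"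
      by (simp add: algebra_simps)
    moreover have "Q \<theta> = (exp (\<sigma>\<^sup>2 * \<theta>) - 1
        + exp (\<sigma>\<^sup>2 * \<theta>) * (u \<theta> * (S \<theta> - u \<theta>) - S \<theta>)) / \<theta>"
      using elim by (simp add: Q_def add_divide_distrib diff_divide_distrib right_diff_distrib)
    ultimately show ?case by simp
  qed
  ultimately show ?thesis by (rule Lim_transform_eventually)
qed

theorem theoremB:
  fixes \<mu> \<sigma> :: real
  assumes "\<mu> > 0" and "\<sigma> > 0"
  shows "(profit_bar \<mu> \<sigma> has_real_derivative \<sigma>\<^sup>2) (at_right 0)
       \<and> (\<lambda>\<theta>. profit_bar \<mu> \<sigma> \<theta> - (1 + \<sigma>\<^sup>2 * \<theta>)) \<in> o[at_right 0](\<lambda>\<theta>. \<theta>)"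
proof
  note lim = profit_bar_difference_quotient[OF assms]
  show "(profit_bar \<mu> \<sigma> has_real_derivative \<sigma>\<^sup>2) (at_right 0)"
    using lim by (simp add: has_field_derivative_iff profit_bar_def[of _ _ 0])
  have nz: "\<forall>\<^sub>F \<theta> :: real in at_right 0. \<theta> \<noteq> 0"
    using eventually_at_right_less[of 0] by eventually_elim simp
  show "(\<lambda>\<theta>. profit_bar \<mu> \<sigma> \<theta> - (1 + \<sigma>\<^sup>2 * \<theta>)) \<in> o[at_right 0](\<lambda>\<theta>. \<theta>)"
  proof (rule smalloI_tendsto[OF _ nz])
    have "((\<lambda>\<theta>. (profit_bar \<mu> \<sigma> \<theta> - 1) / \<theta> - \<sigma>\<^sup>2) \<longlongrightarrow> 0) (at_right 0)"
      using lim by (simp add: LIM_zero_iff)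
    moreover have "\<forall>\<^sub>F \<theta> in at_right 0. (profit_bar \<mu> \<sigma> \<theta> - 1) / \<theta> - \<sigma>\<^sup>2
        = (profit_bar \<mu> \<sigma> \<theta> - (1 + \<sigma>\<^sup>2 * \<theta>)) / \<theta>"
      using nz by eventually_elim (simp add: field_simps)
    ultimately show "((\<lambda>\<theta>. (profit_bar \<mu> \<sigma> \<theta> - (1 + \<sigma>\<^sup>2 * \<theta>)) / \<theta>) \<longlongrightarrow> 0) (at_right 0)"
      by (rule Lim_transform_eventually)
  qed
qed

end
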